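(* The Three Subobjects Lemma fails for the following (skew) braces $A$: (1) the brace $A$ of order $16$ with $(A,+)=\mathbb{Z}_4\times\mathbb{Z}_4$ (component-wise sum) and $$(a,c)\circ(b,d)=(a+(-1)^c b+d\,v_\xi^1,\ c+d\,v_\xi^2),\qquad \xi:=2a+c\in\mathbb{Z}_4,$$ where $v_0=(0,1)$, $v_1=(2,3)$, $v_2=(3,3)$, $v_3=(3,1)$ and $v_\xi=(v_\xi^1,v_\xi^2)$; (2) for every prime $p\neq 2$, the brace $A=\mathbb{F}_p^4$ of order $p^4$ with component-wise sum and $$(a,b,c,d)\circ(a',b',c',d')=(a+a',\,b+b',\,c+c'+aa',\,d+d'+(2c-a^2)b').$$ That is, for each of these braces $A$ there exist ideals $K,L,M$ of $A$ such that $$[[L,M],K]\not\subseteq [[K,L],M]\vee[[M,K],L].$$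
   Context: A skew brace is a triple $(A,+,\circ)$ where $(A,+)$ and $(A,\circ)$ are groups sharing the same identity element and satisfying $a\circ(b+c)=a\circ b-a+a\circ c$ for all $a,b,c\in A$; it is a brace if $(A,+)$ is abelian. Put $\lambda_a(x):=-a+a\circ x$ and $a\star b:=\lambda_a(b)-b$. An ideal of $A$ is a subset $X\subseteq A$ that is a normal subgroup of $(A,+)$, a normal subgroup of $(A,\circ)$, and satisfies $\lambda_a(X)\subseteq X$ for all $a\in A$. Given ideals $I,J$ of $A$, their Huq commutator $[I,J]$ is the ideal of $A$ generated by all elements $[x,y]_+$, $[x,y]_\circ$, $x\star y$ with $x\in I$, $y\in J$, where $[\cdot,\cdot]_+$ and $[\cdot,\cdot]_\circ$ are the commutators in the groups $(A,+)$ and $(A,\circ)$. The join $I\vee J$ is the ideal generated by $I\cup J$. The Three Subobjects Lemma for $A$ is the assertion that $[[L,M],K]\subseteq[[K,L],M]\vee[[M,K],L]$ for all ideals $K,L,M$ of $A$. *)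

theory Defs
  imports "HOL-Algebra.Coset" "HOL-Algebra.Ring" "HOL-Computational_Algebra.Primes"
begin

text \<open>
  A skew brace is carried by the record type of rings: \<open>\<oplus>\<close> is the additive group operation
  and \<open>\<otimes>\<close> is the circle operation. The additive group need not be abelian.
\<close>

locale skew_brace = group A + a: group "add_monoid A"
  for A :: "('a, 'm) ring_scheme" (structure) +
  assumes one_eq_zero: "\<one> = \<zero>"
    and brace_distrib:
      "\<lbrakk>x \<in> carrier A; y \<in> carrier A; z \<in> carrier A\<rbrakk>
        \<Longrightarrow> x \<otimes> (y \<oplus> z) = ((x \<otimes> y) \<ominus> x) \<oplus> (x \<otimes> z)"

locale brace = skew_brace + abelian_group A

definition brace_lambda :: "('a, 'm) ring_scheme \<Rightarrow> 'a \<Rightarrow> 'a \<Rightarrow> 'a" where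
  "brace_lambda A x y = (\<ominus>\<^bsub>A\<^esub> x) \<oplus>\<^bsub>A\<^esub> (x \<otimes>\<^bsub>A\<^esub> y)"

definition brace_star :: "('a, 'm) ring_scheme \<Rightarrow> 'a \<Rightarrow> 'a \<Rightarrow> 'a" where
  "brace_star A x y = brace_lambda A x y \<ominus>\<^bsub>A\<^esub> y"

definition brace_ideal :: "('a, 'm) ring_scheme \<Rightarrow> 'a set \<Rightarrow> bool" where
  "brace_ideal A X \<longleftrightarrow>
     X \<lhd> add_monoid A \<and> X \<lhd> A \<and> (\<forall>x\<in>carrier A. brace_lambda A x ` X \<subseteq> X)"

definition gen_brace_ideal :: "('a, 'm) ring_scheme \<Rightarrow> 'a set \<Rightarrow> 'a set" where
  "gen_brace_ideal A S = \<Inter>{X. brace_ideal A X \<and> S \<subseteq> X}"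

definition group_commutator :: "('a, 'm) monoid_scheme \<Rightarrow> 'a \<Rightarrow> 'a \<Rightarrow> 'a" where
  "group_commutator G x y = x \<otimes>\<^bsub>G\<^esub> y \<otimes>\<^bsub>G\<^esub> inv\<^bsub>G\<^esub> x \<otimes>\<^bsub>G\<^esub> inv\<^bsub>G\<^esub> y"

definition huq_commutator :: "('a, 'm) ring_scheme \<Rightarrow> 'a set \<Rightarrow> 'a set \<Rightarrow> 'a set" where
  "huq_commutator A I J = gen_brace_ideal A
     (\<Union>x\<in>I. \<Union>y\<in>J.
        {group_commutator (add_monoid A) x y, group_commutator A x y, brace_star A x y})"

definition ideal_join :: "('a, 'm) ring_scheme \<Rightarrow> 'a set \<Rightarrow> 'a set \<Rightarrow> 'a set" where
  "ideal_join A I J = gen_brace_ideal A (I \<union> J)"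

definition three_subobjects_lemma :: "('a, 'm) ring_scheme \<Rightarrow> bool" where
  "three_subobjects_lemma A \<longleftrightarrow>
     (\<forall>K L M. brace_ideal A K \<longrightarrow> brace_ideal A L \<longrightarrow> brace_ideal A M \<longrightarrow>
        huq_commutator A (huq_commutator A L M) K \<subseteq>
          ideal_join A (huq_commutator A (huq_commutator A K L) M)
                       (huq_commutator A (huq_commutator A M K) L))"

text \<open>
  The integers modulo \<open>n\<close> are represented by the residues \<open>{0..<n}\<close>. In particular
  \<open>(-1)\<^sup>c\<close> below is well defined, since the parity of \<open>c\<close> only depends on \<open>c\<close> modulo 4.
\<close>

definition v_vec :: "int \<Rightarrow> int \<times> int" where
  "v_vec \<xi> = [(0, 1), (2, 3), (3, 3), (3, 1)] ! nat (\<xi> mod 4)"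

definition brace16 :: "(int \<times> int) ring" where
  "brace16 = \<lparr>
     carrier = {0..<4} \<times> {0..<4},
     monoid.mult = (\<lambda>(a, c) (b, d).
       let \<xi> = 2 * a + c
       in ((a + (-1) ^ nat c * b + d * fst (v_vec \<xi>)) mod 4, (c + d * snd (v_vec \<xi>)) mod 4)),
     one = (0, 0),
     zero = (0, 0),
     add = (\<lambda>(a, c) (b, d). ((a + b) mod 4, (c + d) mod 4))\<rparr>"

definition brace_p4 :: "nat \<Rightarrow> (int \<times> int \<times> int \<times> int) ring" where
  "brace_p4 p = \<lparr>
     carrier = {0..<int p} \<times> {0..<int p} \<times> {0..<int p} \<times> {0..<int p},
     monoid.mult = (\<lambda>(a, b, c, d) (a', b', c', d').
       ((a + a') mod int p, (b + b') mod int p, (c + c' + a * a') mod int p,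
        (d + d' + (2 * c - a ^ 2) * b') mod int p)),
     one = (0, 0, 0, 0),
     zero = (0, 0, 0, 0),
     add = (\<lambda>(a, b, c, d) (a', b', c', d').
       ((a + a') mod int p, (b + b') mod int p, (c + c') mod int p, (d + d') mod int p))\<rparr>"

end

(* Take L = M = A. In both braces there are an ideal K and an additive subgroup D of K such that
   all star products of K with A, on either side, lie in D, and all star products of D with A
   vanish. Hence [K, A] and [A, K] lie in D, and [[K, A], A] = [[A, K], A] = 0. On the other hand
   (x * y) * k is nonzero for suitable x, y in A and k in K, so that [[A, A], K] is nonzero.
   For order 16, K is generated by (1, 2) and D by (2, 0); for order p^4, K is the set a = 0 and
   D the set a = b = c = 0, and the nonzero element is (0, 0, 0, 2), which is where p is odd. *)

theory Submission 
  imports Defs "HOL-Number_Theory.Cong"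
begin

text \<open>
  In the context of the locale \<open>brace\<close> the facts of \<open>abelian_group\<close> about \<open>\<oplus>\<close> are unavailable, because
  the additive group has already been interpreted without rewriting \<open>add_monoid\<close>. The following
  locale imports \<open>abelian_group\<close> first; the lemma \<open>brace_axioms\<close> below leads back.
\<close>

locale abelian_brace = abelian_group A + group A
  for A :: "('a, 'm) ring_scheme" (structure) +
  assumes one_eq_zero: "\<one> = \<zero>"
    and mult_add_add:
      "\<lbrakk>x \<in> carrier A; y \<in> carrier A; z \<in> carrier A\<rbrakk>
        \<Longrightarrow> x \<otimes> (y \<oplus> z) \<oplus> x = (x \<otimes> y) \<oplus> (x \<otimes> z)"
begin

text \<open>Recovers the axiom of \<open>skew_brace\<close>. The locale assumes
  \<open>mult_add_add\<close> instead, where the subtracted \<open>x\<close> is moved to the other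
  side: free of \<open>\<ominus>\<close>, it can be evaluated directly in a concrete brace.\<close>

lemma brace_distrib:
  assumes "x \<in> carrier A" "y \<in> carrier A" "z \<in> carrier A"
  shows "x \<otimes> (y \<oplus> z) = ((x \<otimes> y) \<ominus> x) \<oplus> (x \<otimes> z)"
proof -
  have "x \<otimes> (y \<oplus> z) = (x \<otimes> (y \<oplus> z) \<oplus> x) \<ominus> x"
    using assms by (simp add: minus_eq a_assoc r_neg)
  also have "\<dots> = (x \<otimes> y) \<oplus> (x \<otimes> z) \<ominus> x"
    using assms by (simp only: mult_add_add)
  finally show ?thesis
    using assms by (simp add: minus_eq a_ac)
qed

lemma brace_axioms: "brace A"
  by (intro brace.intro skew_brace.intro skew_brace_axioms.intro)
    (auto simp: one_eq_zero brace_distrib group_axioms abelian_group_axioms a_group)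

lemma mult_eq_add_star:
  assumes "x \<in> carrier A" "y \<in> carrier A"
  shows "x \<otimes> y = x \<oplus> y \<oplus> brace_star A x y"
  using assms by (simp add: brace_star_def brace_lambda_def minus_eq a_ac r_neg1 r_neg2)

lemma star_closed [simp]:
  assumes "x \<in> carrier A" "y \<in> carrier A"
  shows "brace_star A x y \<in> carrier A"
  using assms by (simp add: brace_star_def brace_lambda_def minus_eq)

text \<open>Cancellation in \<open>mult_eq_add_star\<close>: star products can be read off from the
  two operations without computing an additive inverse.\<close>

lemma star_eqI:
  assumes "x \<in> carrier A" "y \<in> carrier A" "t \<in> carrier A" "x \<otimes> y = x \<oplus> y \<oplus> t"
  shows "brace_star A x y = t"
  using assms mult_eq_add_star[of x y] by (simp add: a_assoc)

text \<open>For explicit finite sets the existential premise can be settled by evaluation.\<close>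

lemma star_memI:
  assumes "D \<subseteq> carrier A" "x \<in> carrier A" "y \<in> carrier A" "\<exists>t\<in>D. x \<otimes> y = x \<oplus> y \<oplus> t"
  shows "brace_star A x y \<in> D"
  using assms star_eqI by blast

lemma lambda_eq_star_add:
  assumes "x \<in> carrier A" "y \<in> carrier A"
  shows "brace_lambda A x y = brace_star A x y \<oplus> y"
  using assms by (simp add: brace_star_def brace_lambda_def minus_eq a_assoc l_neg)

section \<open>Ideals and Huq commutators through star products\<close>

text \<open>Everything reduces to values of \<open>brace_lambda\<close>, which stay in
  \<open>X\<close> by \<open>lambda_eq_star_add\<close>: a circle inverse is minus such a value, and
  so is, without the sign, a circle conjugate. Additive normality is automatic for an abelian
  group.\<close>

lemma brace_idealI:
  assumes sub: "subgroup X (add_monoid A)"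
    and star_left: "\<And>h x. h \<in> X \<Longrightarrow> x \<in> carrier A \<Longrightarrow> brace_star A h x \<in> X"
    and star_right: "\<And>h x. h \<in> X \<Longrightarrow> x \<in> carrier A \<Longrightarrow> brace_star A x h \<in> X"
  shows "brace_ideal A X"
proof -
  have carr [simp]: "h \<in> carrier A" if "h \<in> X" for h
    using subgroup.mem_carrier[OF sub that] by simp
  have add: "h \<oplus> k \<in> X" if "h \<in> X" "k \<in> X" for h k
    using subgroup.m_closed[OF sub that] by simp
  have zero: "\<zero> \<in> X"
    using subgroup.one_closed[OF sub] by simp
  have minus: "\<ominus> h \<in> X" if "h \<in> X" for h
    using subgroup.m_inv_closed[OF sub that] by (simp add: a_inv_def)
  have lam: "brace_lambda A x h \<in> X" if "x \<in> carrier A" "h \<in> X" for x h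
    using that by (simp add: lambda_eq_star_add add star_right)
  have mult_lam: "x \<otimes> y = x \<oplus> brace_lambda A x y" if "x \<in> carrier A" "y \<in> carrier A" for x y
    using that by (simp add: brace_lambda_def r_neg2)
  have inv: "inv h \<in> X" if h: "h \<in> X" for h
  proof -
    have "inv h \<oplus> brace_lambda A (inv h) h = \<zero>"
      using h by (simp flip: mult_lam add: one_eq_zero)
    then have "inv h = \<ominus> brace_lambda A (inv h) h"
      using h by (metis carr inv_closed lam minus_equality)
    with lam[of "inv h" h] minus h show ?thesis by (metis carr inv_closed)
  qed
  have "subgroup X A"
    using zero by (intro subgroupI) (auto simp: inv mult_lam add lam)
  moreover have "x \<otimes> h \<otimes> inv x \<in> X" if x: "x \<in> carrier A" and h: "h \<in> X" for x h
  proof -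
    \<comment> \<open>Chosen so that \<open>h \<otimes> inv x = k \<oplus> inv x\<close>;
      distributing \<open>x\<close> over this sum turns the conjugate into
      \<open>brace_lambda A x k\<close>.\<close>
    define k where "k = h \<oplus> brace_star A h (inv x)"
    have k: "k \<in> X" using x h by (simp add: k_def add star_left)
    have "x \<otimes> h \<otimes> inv x = x \<otimes> (k \<oplus> inv x)"
      using x h by (simp add: m_assoc mult_eq_add_star[of h] k_def a_ac)
    also have "\<dots> = (x \<otimes> k \<ominus> x) \<oplus> (x \<otimes> inv x)"
      using x k by (intro brace_distrib) auto
    also have "\<dots> = brace_lambda A x k"
      using x k by (simp add: one_eq_zero brace_lambda_def minus_eq a_ac)
    finally show ?thesis using lam[OF x k] by simp
  qed
  ultimately have "X \<lhd> A" by (simp add: normal_inv_iff)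
  moreover have "X \<lhd> add_monoid A"
    using sub comm_group.normal_iff_subgroup[OF a_comm_group] by blast
  ultimately show ?thesis using lam by (auto simp: brace_ideal_def)
qed

text \<open>Additive commutators vanish, so only circle commutators need work. Star products in both
  orders are required because \<open>x \<otimes> y\<close> and \<open>y \<otimes> x\<close> differ
  additively by the difference of the two.\<close>

lemma huq_commutator_subset:
  assumes D: "brace_ideal A D" and I: "I \<subseteq> carrier A" and J: "J \<subseteq> carrier A"
    and star: "\<And>x y. x \<in> I \<Longrightarrow> y \<in> J \<Longrightarrow> brace_star A x y \<in> D \<and> brace_star A y x \<in> D"
  shows "huq_commutator A I J \<subseteq> D"
proof -
  have subA: "subgroup D (add_monoid A)" and normM: "D \<lhd> A"
    and lam: "\<And>x h. x \<in> carrier A \<Longrightarrow> h \<in> D \<Longrightarrow> brace_lambda A x h \<in> D"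
    using D by (auto simp: brace_ideal_def normal_imp_subgroup)
  have add: "h \<oplus> k \<in> D" if "h \<in> D" "k \<in> D" for h k
    using subgroup.m_closed[OF subA that] by simp
  have zero: "\<zero> \<in> D"
    using subgroup.one_closed[OF subA] by simp
  have minus: "\<ominus> h \<in> D" if "h \<in> D" for h
    using subgroup.m_inv_closed[OF subA that] by (simp add: a_inv_def)
  have "group_commutator (add_monoid A) x y = \<zero>" if "x \<in> carrier A" "y \<in> carrier A" for x y
    using that r_neg[of "x \<oplus> y"] by (simp add: group_commutator_def minus_add a_ac flip: a_inv_def)
  moreover have "group_commutator A x y \<in> D" if xI: "x \<in> I" and yJ: "y \<in> J" for x y
  proof -
    have x [simp]: "x \<in> carrier A" and y [simp]: "y \<in> carrier A" using xI yJ I J by auto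
    define w where "w = y \<otimes> x"
    define d where "d = brace_star A x y \<ominus> brace_star A y x"
    have w [simp]: "w \<in> carrier A" by (simp add: w_def)
    have dD: "d \<in> D" using star[OF xI yJ] by (simp add: d_def minus_eq add minus)
    have d [simp]: "d \<in> carrier A" by (simp add: d_def minus_eq)
    have "w \<oplus> d = x \<otimes> y"
      unfolding w_def d_def mult_eq_add_star[OF x y] mult_eq_add_star[OF y x]
      by (simp add: minus_eq a_ac r_neg1 r_neg2 r_neg)
    then have "inv w \<otimes> (x \<otimes> y) = inv w \<otimes> (w \<oplus> d)" by simp
    also have "\<dots> = (inv w \<otimes> w \<ominus> inv w) \<oplus> inv w \<otimes> d"
      by (rule brace_distrib) auto
    also have "\<dots> = brace_lambda A (inv w) d"
      by (simp add: one_eq_zero brace_lambda_def minus_eq)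
    finally have "inv w \<otimes> (x \<otimes> y) \<in> D" using lam[of "inv w" d] dD by simp
    \<comment> \<open>Conjugation by \<open>w\<close> carries
      \<open>inv w \<otimes> (x \<otimes> y)\<close> to
      \<open>x \<otimes> y \<otimes> inv w\<close>, which is the circle commutator of
      \<open>x\<close> and \<open>y\<close>.\<close>
    then have "w \<otimes> (inv w \<otimes> (x \<otimes> y)) \<otimes> inv w \<in> D"
      using normM w unfolding normal_inv_iff by blast
    moreover have "w \<otimes> (inv w \<otimes> (x \<otimes> y)) = x \<otimes> y" by (simp flip: m_assoc)
    ultimately have "x \<otimes> y \<otimes> inv w \<in> D" by (simp only:)
    then show ?thesis
      by (simp add: group_commutator_def w_def inv_mult_group m_assoc)
  qed
  ultimately have "(\<Union>x\<in>I. \<Union>y\<in>J.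
      {group_commutator (add_monoid A) x y, group_commutator A x y, brace_star A x y}) \<subseteq> D"
    using star zero I J by (auto 4 3)
  then show ?thesis
    using D by (auto simp: huq_commutator_def gen_brace_ideal_def)
qed

lemma star_in_huq_commutator:
  assumes "x \<in> I" "y \<in> J"
  shows "brace_star A x y \<in> huq_commutator A I J"
  using assms by (auto simp: huq_commutator_def gen_brace_ideal_def)

lemma star_zero [simp]:
  assumes "x \<in> carrier A"
  shows "brace_star A x \<zero> = \<zero>" "brace_star A \<zero> x = \<zero>"
  using assms r_one l_one by (auto intro!: star_eqI simp: one_eq_zero)

text \<open>The criterion shared by both families: it leaves only subgroup checks and star products
  to be computed in each concrete brace.\<close>

lemma not_three_subobjects_lemma:
  assumes K: "subgroup K (add_monoid A)" and D: "subgroup D (add_monoid A)" and "D \<subseteq> K"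
    and K_star: "\<And>k x. k \<in> K \<Longrightarrow> x \<in> carrier A \<Longrightarrow> brace_star A k x \<in> D \<and> brace_star A x k \<in> D"
    and D_star: "\<And>d x. d \<in> D \<Longrightarrow> x \<in> carrier A \<Longrightarrow> brace_star A d x = \<zero> \<and> brace_star A x d = \<zero>"
    and wit: "x \<in> carrier A" "y \<in> carrier A" "k \<in> K" "brace_star A (brace_star A x y) k \<noteq> \<zero>"
  shows "\<not> three_subobjects_lemma A"
proof
  assume *: "three_subobjects_lemma A"
  let ?L = "carrier A"
  have KL: "K \<subseteq> ?L" and DL: "D \<subseteq> ?L" using subgroup.subset[OF K] subgroup.subset[OF D] by auto
  have Ki: "brace_ideal A K" using K_star \<open>D \<subseteq> K\<close> by (intro brace_idealI[OF K]) blast+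
  have Di: "brace_ideal A D"
    using D_star subgroup.one_closed[OF D] by (intro brace_idealI[OF D]) auto
  have Li: "brace_ideal A ?L"
    using group.subgroup_self[OF a_group] by (intro brace_idealI) auto
  have Zi: "brace_ideal A {\<zero>}"
    using group.triv_subgroup[OF a_group] by (intro brace_idealI) auto
  have "huq_commutator A K ?L \<subseteq> D" "huq_commutator A ?L K \<subseteq> D"
    using K_star KL by (intro huq_commutator_subset[OF Di]; blast)+
  then have "huq_commutator A (huq_commutator A K ?L) ?L \<subseteq> {\<zero>}"
    "huq_commutator A (huq_commutator A ?L K) ?L \<subseteq> {\<zero>}"
    using D_star DL by (intro huq_commutator_subset[OF Zi]; blast)+
  then have "ideal_join A (huq_commutator A (huq_commutator A K ?L) ?L)
      (huq_commutator A (huq_commutator A ?L K) ?L) \<subseteq> {\<zero>}"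
    using Zi unfolding ideal_join_def gen_brace_ideal_def by blast
  \<comment> \<open>The inner star product lies in [A, A], hence the outer one in [[A, A],
    K].\<close>
  moreover have "brace_star A (brace_star A x y) k \<in> huq_commutator A (huq_commutator A ?L ?L) K"
    using wit by (intro star_in_huq_commutator)
  ultimately show False
    using * Ki Li wit(4) unfolding three_subobjects_lemma_def by blast
qed

end

text \<open>Inverses enter through an equation, so that \<open>a_inv\<close> need not be unfolded in
  the concrete records.\<close>

lemma add_subgroupI:
  fixes A (structure)
  assumes "abelian_group A" and sub: "X \<subseteq> carrier A" and zero: "\<zero> \<in> X"
    and add: "\<And>x y. x \<in> X \<Longrightarrow> y \<in> X \<Longrightarrow> x \<oplus> y \<in> X"
    and inv: "\<And>x. x \<in> X \<Longrightarrow> \<exists>y\<in>X. y \<oplus> x = \<zero>"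
  shows "subgroup X (add_monoid A)"
proof -
  interpret abelian_group A by fact
  have "\<ominus> x \<in> X" if "x \<in> X" for x
    using inv[OF that] sub that minus_equality by (metis subsetD)
  then show ?thesis
    using sub zero add by (intro group.subgroupI[OF a_group]) (auto simp: a_inv_def)
qed


section \<open>The brace of order 16\<close>

text \<open>The axioms are bounded statements about at most three of the 16 elements, settled by
  exhaustive evaluation.\<close>

lemma abelian_brace_brace16: "abelian_brace brace16"
proof -
  let ?S = "carrier brace16"
  have "\<forall>x\<in>?S. \<forall>y\<in>?S. x \<otimes>\<^bsub>brace16\<^esub> y \<in> ?S \<and> x \<oplus>\<^bsub>brace16\<^esub> y \<in> ?S
      \<and> x \<oplus>\<^bsub>brace16\<^esub> y = y \<oplus>\<^bsub>brace16\<^esub> x"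
    by code_simp
  moreover have "\<forall>x\<in>?S. \<forall>y\<in>?S. \<forall>z\<in>?S.
      x \<otimes>\<^bsub>brace16\<^esub> y \<otimes>\<^bsub>brace16\<^esub> z = x \<otimes>\<^bsub>brace16\<^esub> (y \<otimes>\<^bsub>brace16\<^esub> z)
    \<and> x \<oplus>\<^bsub>brace16\<^esub> y \<oplus>\<^bsub>brace16\<^esub> z = x \<oplus>\<^bsub>brace16\<^esub> (y \<oplus>\<^bsub>brace16\<^esub> z)
    \<and> x \<otimes>\<^bsub>brace16\<^esub> (y \<oplus>\<^bsub>brace16\<^esub> z) \<oplus>\<^bsub>brace16\<^esub> x
        = (x \<otimes>\<^bsub>brace16\<^esub> y) \<oplus>\<^bsub>brace16\<^esub> (x \<otimes>\<^bsub>brace16\<^esub> z)"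
    by code_simp
  moreover have "\<forall>x\<in>?S. \<one>\<^bsub>brace16\<^esub> \<otimes>\<^bsub>brace16\<^esub> x = x
      \<and> \<zero>\<^bsub>brace16\<^esub> \<oplus>\<^bsub>brace16\<^esub> x = x
      \<and> (\<exists>y\<in>?S. y \<otimes>\<^bsub>brace16\<^esub> x = \<one>\<^bsub>brace16\<^esub>) \<and> (\<exists>y\<in>?S. y \<oplus>\<^bsub>brace16\<^esub> x = \<zero>\<^bsub>brace16\<^esub>)"
    by code_simp
  moreover have "\<one>\<^bsub>brace16\<^esub> \<in> ?S" "\<zero>\<^bsub>brace16\<^esub> \<in> ?S" "\<one>\<^bsub>brace16\<^esub> = \<zero>\<^bsub>brace16\<^esub>"
    by (auto simp: brace16_def)
  ultimately show ?thesis
    by (intro abelian_brace.intro abelian_groupI groupI abelian_brace_axioms.intro) simp_all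
qed

lemma not_three_subobjects_lemma_brace16: "\<not> three_subobjects_lemma brace16"
proof -
  interpret abelian_brace brace16 by (rule abelian_brace_brace16)
  let ?S = "carrier brace16"
  let ?K = "{(0, 0), (1, 2), (2, 0), (3, 2)} :: (int \<times> int) set"
  let ?D = "{(0, 0), (2, 0)} :: (int \<times> int) set"
  show ?thesis
  proof (rule not_three_subobjects_lemma)
    show "subgroup ?K (add_monoid brace16)" "subgroup ?D (add_monoid brace16)"
      by (rule add_subgroupI[OF abelian_group_axioms]; auto simp: brace16_def)+
    show "?D \<subseteq> ?K" by simp
    have KS: "?K \<subseteq> ?S" and DS: "?D \<subseteq> ?S" and ZS: "{\<zero>\<^bsub>brace16\<^esub>} \<subseteq> ?S"
      by (simp_all add: brace16_def)
    have KD: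
      "\<forall>k\<in>?K. \<forall>x\<in>?S. \<exists>t\<in>?D. k \<otimes>\<^bsub>brace16\<^esub> x = k \<oplus>\<^bsub>brace16\<^esub> x \<oplus>\<^bsub>brace16\<^esub> t"
      "\<forall>k\<in>?K. \<forall>x\<in>?S. \<exists>t\<in>?D. x \<otimes>\<^bsub>brace16\<^esub> k = x \<oplus>\<^bsub>brace16\<^esub> k \<oplus>\<^bsub>brace16\<^esub> t"
      by code_simp+
    show "brace_star brace16 k x \<in> ?D \<and> brace_star brace16 x k \<in> ?D"
      if "k \<in> ?K" "x \<in> ?S" for k x
      using that(2) subsetD[OF KS that(1)] bspec[OF bspec[OF KD(1) that(1)] that(2)]
        bspec[OF bspec[OF KD(2) that(1)] that(2)]
      by (intro conjI star_memI[OF DS])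
    \<comment> \<open>The singleton in place of \<open>?D\<close> lets \<open>star_memI\<close>
      express vanishing as membership.\<close>
    have DZ:
      "\<forall>d\<in>?D. \<forall>x\<in>?S. \<exists>t\<in>{\<zero>\<^bsub>brace16\<^esub>}. d \<otimes>\<^bsub>brace16\<^esub> x = d \<oplus>\<^bsub>brace16\<^esub> x \<oplus>\<^bsub>brace16\<^esub> t"
      "\<forall>d\<in>?D. \<forall>x\<in>?S. \<exists>t\<in>{\<zero>\<^bsub>brace16\<^esub>}. x \<otimes>\<^bsub>brace16\<^esub> d = x \<oplus>\<^bsub>brace16\<^esub> d \<oplus>\<^bsub>brace16\<^esub> t"
      by code_simp+
    show "brace_star brace16 d x = \<zero>\<^bsub>brace16\<^esub> \<and> brace_star brace16 x d = \<zero>\<^bsub>brace16\<^esub>"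
      if "d \<in> ?D" "x \<in> ?S" for d x
      using that(2) subsetD[OF DS that(1)] bspec[OF bspec[OF DZ(1) that(1)] that(2)]
        bspec[OF bspec[OF DZ(2) that(1)] that(2)]
      by (intro conjI singletonD[OF star_memI[OF ZS]])
    show "(0, 1) \<in> ?S" "(0, 1) \<in> ?S" "(1, 2) \<in> ?K" by (auto simp: brace16_def)
    \<comment> \<open>The circle product of \<open>(0, 1)\<close> with itself is
      \<open>(2, 0)\<close>, the sum \<open>(0, 2)\<close>. For \<open>(2, 2)\<close> and
      \<open>(1, 2)\<close> they are \<open>(1, 0)\<close> and \<open>(3, 0)\<close>.\<close>
    have "brace_star brace16 (0, 1) (0, 1) = (2, 2)"
      by (rule star_eqI) (auto simp: brace16_def v_vec_def)
    moreover have "brace_star brace16 (2, 2) (1, 2) = (2, 0)"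
      by (rule star_eqI) (auto simp: brace16_def v_vec_def)
    ultimately show "brace_star brace16 (brace_star brace16 (0, 1) (0, 1)) (1, 2) \<noteq> \<zero>\<^bsub>brace16\<^esub>"
      by (simp add: brace16_def)
  qed
qed

section \<open>The braces of order p^4\<close>

lemma
  shows carrier_brace_p4: "carrier (brace_p4 p) = {0..<int p} \<times> {0..<int p} \<times> {0..<int p} \<times> {0..<int p}"
    and mult_brace_p4: "(a, b, c, d) \<otimes>\<^bsub>brace_p4 p\<^esub> (a', b', c', d') =
      ((a + a') mod int p, (b + b') mod int p, (c + c' + a * a') mod int p,
        (d + d' + (2 * c - a ^ 2) * b') mod int p)"
    and add_brace_p4: "(a, b, c, d) \<oplus>\<^bsub>brace_p4 p\<^esub> (a', b', c', d') =
      ((a + a') mod int p, (b + b') mod int p, (c + c') mod int p, (d + d') mod int p)"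
    and one_brace_p4: "\<one>\<^bsub>brace_p4 p\<^esub> = (0, 0, 0, 0)"
    and zero_brace_p4: "\<zero>\<^bsub>brace_p4 p\<^esub> = (0, 0, 0, 0)"
  by (simp_all add: brace_p4_def)

lemmas brace_p4_simps =
  carrier_brace_p4 mult_brace_p4 add_brace_p4 one_brace_p4 zero_brace_p4

text \<open>The axioms come from integer polynomial identities: congruences strip the inner
  reductions modulo \<open>p\<close>, and the remaining expressions agree over the integers.\<close>

lemma abelian_brace_brace_p4:
  assumes "p > 0"
  shows "abelian_brace (brace_p4 p)"
proof -
  let ?A = "brace_p4 p"
  have mult_assoc: "x \<otimes>\<^bsub>?A\<^esub> y \<otimes>\<^bsub>?A\<^esub> z = x \<otimes>\<^bsub>?A\<^esub> (y \<otimes>\<^bsub>?A\<^esub> z)" for x y z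
  proof -
    obtain a b c d a' b' c' d' a'' b'' c'' d''
      where xyz: "x = (a, b, c, d)" "y = (a', b', c', d')" "z = (a'', b'', c'', d'')"
      by (metis prod_cases4)
    have "x \<otimes>\<^bsub>?A\<^esub> y \<otimes>\<^bsub>?A\<^esub> z =
      ((a + a' + a'') mod int p, (b + b' + b'') mod int p,
       (c + c' + a * a' + c'' + (a + a') * a'') mod int p,
       (d + d' + (2 * c - a\<^sup>2) * b' + d'' + (2 * (c + c' + a * a') - (a + a')\<^sup>2) * b'') mod int p)"
      unfolding xyz mult_brace_p4 prod.inject cong_def[symmetric]
      by (intro conjI cong_add cong_diff cong_mult cong_pow cong_refl) simp_all
    \<comment> \<open>The key to associativity: \<open>2 * c - a\<^sup>2\<close> is additive along
      the circle operation, as \<open>2 * (c + c' + a * a') - (a + a')\<^sup>2\<close> is the sum of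
      its values at \<open>x\<close> and \<open>y\<close>.\<close>
    also have "\<dots> =
      ((a + (a' + a'')) mod int p, (b + (b' + b'')) mod int p,
       (c + (c' + c'' + a' * a'') + a * (a' + a'')) mod int p,
       (d + (d' + d'' + (2 * c' - a'\<^sup>2) * b'') + (2 * c - a\<^sup>2) * (b' + b'')) mod int p)"
      by (simp add: algebra_simps power2_eq_square)
    also have "\<dots> = x \<otimes>\<^bsub>?A\<^esub> (y \<otimes>\<^bsub>?A\<^esub> z)"
      unfolding xyz mult_brace_p4 prod.inject cong_def[symmetric]
      by (intro conjI cong_add cong_diff cong_mult cong_pow cong_refl) simp_all
    finally show ?thesis .
  qed
  have distrib: "x \<otimes>\<^bsub>?A\<^esub> (y \<oplus>\<^bsub>?A\<^esub> z) \<oplus>\<^bsub>?A\<^esub> x = (x \<otimes>\<^bsub>?A\<^esub> y) \<oplus>\<^bsub>?A\<^esub> (x \<otimes>\<^bsub>?A\<^esub> z)" for x y z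
  proof -
    obtain a b c d a' b' c' d' a'' b'' c'' d''
      where xyz: "x = (a, b, c, d)" "y = (a', b', c', d')" "z = (a'', b'', c'', d'')"
      by (metis prod_cases4)
    have "x \<otimes>\<^bsub>?A\<^esub> (y \<oplus>\<^bsub>?A\<^esub> z) \<oplus>\<^bsub>?A\<^esub> x =
      ((a + (a' + a'') + a) mod int p, (b + (b' + b'') + b) mod int p,
       (c + (c' + c'') + a * (a' + a'') + c) mod int p,
       (d + (d' + d'') + (2 * c - a\<^sup>2) * (b' + b'') + d) mod int p)"
      unfolding xyz mult_brace_p4 add_brace_p4 prod.inject cong_def[symmetric]
      by (intro conjI cong_mod_leftI cong_add cong_mult cong_refl)
    also have "\<dots> =
      ((a + a' + (a + a'')) mod int p, (b + b' + (b + b'')) mod int p,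
       (c + c' + a * a' + (c + c'' + a * a'')) mod int p,
       (d + d' + (2 * c - a\<^sup>2) * b' + (d + d'' + (2 * c - a\<^sup>2) * b'')) mod int p)"
      by (simp add: algebra_simps)
    also have "\<dots> = (x \<otimes>\<^bsub>?A\<^esub> y) \<oplus>\<^bsub>?A\<^esub> (x \<otimes>\<^bsub>?A\<^esub> z)"
      unfolding xyz mult_brace_p4 add_brace_p4 prod.inject cong_def[symmetric]
      by (intro conjI cong_add cong_refl) simp_all
    finally show ?thesis .
  qed
  have mult_inv: "\<exists>y\<in>carrier ?A. y \<otimes>\<^bsub>?A\<^esub> x = \<one>\<^bsub>?A\<^esub>" for x
  proof -
    obtain a b c d where x: "x = (a, b, c, d)" by (cases x)
    \<comment> \<open>Solved coordinate by coordinate: \<open>a\<^sup>2 - c\<close> cancels the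
      third, and then \<open>2 * c - a\<^sup>2\<close> changes sign at \<open>?y\<close>, which
      dictates the fourth.\<close>
    let ?y = "((- a) mod int p, (- b) mod int p, (a\<^sup>2 - c) mod int p, (- d + (2 * c - a\<^sup>2) * b) mod int p)"
    have "?y \<otimes>\<^bsub>?A\<^esub> x = ((- a + a) mod int p, (- b + b) mod int p,
        (a\<^sup>2 - c + c + - a * a) mod int p,
        (- d + (2 * c - a\<^sup>2) * b + d + (2 * (a\<^sup>2 - c) - (- a)\<^sup>2) * b) mod int p)"
      unfolding x mult_brace_p4 prod.inject cong_def[symmetric]
      by (intro conjI cong_mod_leftI cong_add cong_diff cong_mult cong_pow cong_refl)
    also have "\<dots> = \<one>\<^bsub>?A\<^esub>"
      by (simp add: one_brace_p4 algebra_simps power2_eq_square)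
    finally have "?y \<otimes>\<^bsub>?A\<^esub> x = \<one>\<^bsub>?A\<^esub>" .
    moreover have "?y \<in> carrier ?A" using assms by (simp add: brace_p4_simps)
    ultimately show ?thesis by blast
  qed
  have add_inv: "\<exists>y\<in>carrier ?A. y \<oplus>\<^bsub>?A\<^esub> x = \<zero>\<^bsub>?A\<^esub>" for x
  proof -
    obtain a b c d where x: "x = (a, b, c, d)" by (cases x)
    have "((- a) mod int p, (- b) mod int p, (- c) mod int p, (- d) mod int p) \<oplus>\<^bsub>?A\<^esub> x = \<zero>\<^bsub>?A\<^esub>"
      by (simp add: x brace_p4_simps mod_simps)
    moreover have "((- a) mod int p, (- b) mod int p, (- c) mod int p, (- d) mod int p) \<in> carrier ?A"
      using assms by (simp add: brace_p4_simps)
    ultimately show ?thesis by blast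
  qed
  show ?thesis
    using assms
    by (intro abelian_brace.intro abelian_groupI groupI abelian_brace_axioms.intro
        mult_assoc distrib mult_inv add_inv)
      (auto simp: brace_p4_simps mod_simps algebra_simps)
qed

lemma brace_star_p4:
  assumes "(a, b, c, d) \<in> carrier (brace_p4 p)" "(a', b', c', d') \<in> carrier (brace_p4 p)"
  shows "brace_star (brace_p4 p) (a, b, c, d) (a', b', c', d') =
    (0, 0, (a * a') mod int p, ((2 * c - a\<^sup>2) * b') mod int p)"
proof -
  have "p > 0" using assms by (auto simp: brace_p4_simps)
  then interpret abelian_brace "brace_p4 p" by (rule abelian_brace_brace_p4)
  show ?thesis
    using assms \<open>p > 0\<close> by (intro star_eqI) (auto simp: brace_p4_simps mod_simps)
qed

lemma not_three_subobjects_lemma_brace_p4: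
  assumes "p > 2"
  shows "\<not> three_subobjects_lemma (brace_p4 p)"
proof -
  interpret abelian_brace "brace_p4 p" by (rule abelian_brace_brace_p4) (use assms in simp)
  let ?P = "{0..<int p}"
  let ?K = "{0} \<times> ?P \<times> ?P \<times> ?P"
  let ?D = "{0} \<times> {0} \<times> {0} \<times> ?P"
  have inv: "\<exists>y\<in>?P. (y + x) mod int p = 0" for x
    using assms by (intro bexI[of _ "(- x) mod int p"]) (auto simp: mod_simps)
  have KS: "?K \<subseteq> carrier (brace_p4 p)" and DS: "?D \<subseteq> carrier (brace_p4 p)"
    using assms by (auto simp: brace_p4_simps)
  show ?thesis
  proof (rule not_three_subobjects_lemma)
    show "subgroup ?K (add_monoid (brace_p4 p))"
      using assms inv by (intro add_subgroupI abelian_group_axioms) (fastforce simp: brace_p4_simps)+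
    show "subgroup ?D (add_monoid (brace_p4 p))"
      using assms inv by (intro add_subgroupI abelian_group_axioms) (fastforce simp: brace_p4_simps)+
    show "?D \<subseteq> ?K" using assms by auto
    \<comment> \<open>If either factor has first coordinate 0, the entry \<open>a * a'\<close>
      vanishes and only the fourth coordinate survives.\<close>
    show "brace_star (brace_p4 p) k x \<in> ?D \<and> brace_star (brace_p4 p) x k \<in> ?D"
      if "k \<in> ?K" "x \<in> carrier (brace_p4 p)" for k x
      using that subsetD[OF KS that(1)] assms by (cases k; cases x) (simp add: brace_star_p4)
    \<comment> \<open>On the left an element of \<open>?D\<close> makes
      \<open>2 * c - a\<^sup>2\<close> zero, on the right it makes \<open>b'\<close> zero.\<close>
    show "brace_star (brace_p4 p) d x = \<zero>\<^bsub>brace_p4 p\<^esub> \<and> brace_star (brace_p4 p) x d = \<zero>\<^bsub>brace_p4 p\<^esub>"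
      if "d \<in> ?D" "x \<in> carrier (brace_p4 p)" for d x
      using that subsetD[OF DS that(1)] assms
      by (cases d; cases x) (simp add: brace_star_p4 zero_brace_p4)
    show "(1, 0, 0, 0) \<in> carrier (brace_p4 p)" "(1, 0, 0, 0) \<in> carrier (brace_p4 p)"
      "(0, 1, 0, 0) \<in> ?K"
      using assms by (auto simp: brace_p4_simps)
    \<comment> \<open>The inner product is \<open>(0, 0, 1, 0)\<close>, whose factor
      \<open>2 * c - a\<^sup>2\<close> is 2, nonzero modulo \<open>p\<close> since
      \<open>p > 2\<close>.\<close>
    show "brace_star (brace_p4 p) (brace_star (brace_p4 p) (1, 0, 0, 0) (1, 0, 0, 0)) (0, 1, 0, 0)
        \<noteq> \<zero>\<^bsub>brace_p4 p\<^esub>"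
      using assms by (simp add: brace_star_p4 brace_p4_simps)
  qed
qed

theorem mainTheorem3:
  shows "(brace brace16 \<and> order brace16 = 16 \<and> \<not> three_subobjects_lemma brace16) \<and>
    (\<forall>p::nat. prime p \<and> p \<noteq> 2 \<longrightarrow>
       brace (brace_p4 p) \<and> order (brace_p4 p) = p ^ 4 \<and>
       \<not> three_subobjects_lemma (brace_p4 p))"
proof (intro conjI allI impI)
  show "brace brace16"
    by (intro abelian_brace.brace_axioms abelian_brace_brace16)
  show "order brace16 = 16"
    by (simp add: order_def brace16_def)
  show "\<not> three_subobjects_lemma brace16"
    by (rule not_three_subobjects_lemma_brace16)
next
  fix p :: nat
  assume p: "prime p \<and> p \<noteq> 2"
  then have "p > 2" using prime_ge_2_nat[of p] by linarith
  then show "brace (brace_p4 p)"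
    by (intro abelian_brace.brace_axioms abelian_brace_brace_p4) simp
  show "order (brace_p4 p) = p ^ 4"
    by (simp add: order_def carrier_brace_p4 card_cartesian_product power4_eq_xxxx)
  show "\<not> three_subobjects_lemma (brace_p4 p)"
    using \<open>p > 2\<close> by (rule not_three_subobjects_lemma_brace_p4)
qed

end
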